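(* For every $a\in\mathbb{C}$ with $\tfrac54-\tfrac12a\notin\{0,-1,-2,\dots\}$, $$F\!\left(a,1-a;\tfrac54-\tfrac12a;\tfrac12-\tfrac14\sqrt3\right)=\frac{(2-\sqrt3)^{a/2-1/4}\,\Gamma(\tfrac13)\,\Gamma(\tfrac54-\tfrac12a)}{3^{5/8-3a/4}\,\sqrt{\pi}\;\Gamma(\tfrac{13}{12}-\tfrac12a)}.$$
   Context: $F(a,b;c;x)=\sum_{n\ge0}\frac{(a,n)(b,n)}{(c,n)(1,n)}x^n$ with $(\alpha,n)=\Gamma(\alpha+n)/\Gamma(\alpha)$ is the Gauss hypergeometric series. For $t>0$ and $s\in\mathbb{C}$, $t^s=e^{s\log t}$ with real logarithm. $1/\Gamma$ is interpreted as $0$ at the poles of $\Gamma$. *)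

theory Defs
  imports "HOL-Analysis.Analysis"
begin

(* pochhammer z n = Gamma (z + n) / Gamma z by pochhammer_Gamma whenever z is not
   a nonpositive integer; at nonpositive integers it is the limiting value
   z * (z + 1) * ... * (z + n - 1), so that the series terminates there.
   The series is a genuine convergent sum for norm x < 1; see hypergeo_F_sums. *)
definition hypergeo_F :: "complex \<Rightarrow> complex \<Rightarrow> complex \<Rightarrow> complex \<Rightarrow> complex" where
  "hypergeo_F a b c x =
     (\<Sum>n. pochhammer a n * pochhammer b n / (pochhammer c n * pochhammer 1 n) * x ^ n)"

lemma hypergeo_F_sums:
  assumes x: "norm x < 1"
  shows "(\<lambda>n. pochhammer a n * pochhammer b n / (pochhammer c n * pochhammer 1 n) * x ^ n)
           sums hypergeo_F a b c x"
proof -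
  define f where
    "f = (\<lambda>n. pochhammer a n * pochhammer b n / (pochhammer c n * pochhammer 1 n) * x ^ n)"
  define q where "q = (\<lambda>n. (a + of_nat n) * (b + of_nat n) / ((c + of_nat n) * (1 + of_nat n)) * x)"
  have step: "f (Suc n) = q n * f n" for n
    by (simp add: f_def q_def pochhammer_Suc mult_ac)
  have lim1: "(\<lambda>n. (u + of_nat n) / (v + of_nat n)) \<longlonglongrightarrow> 1" for u v :: complex
  proof -
    have inf: "filterlim (\<lambda>n. v + of_nat n) at_infinity sequentially"
      by (intro tendsto_add_filterlim_at_infinity[OF tendsto_const] tendsto_of_nat)
    have "(\<lambda>n. 1 + (u - v) / (v + of_nat n)) \<longlonglongrightarrow> 1 + 0"
      by (intro tendsto_add tendsto_const tendsto_divide_0[OF tendsto_const inf])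
    moreover have "eventually (\<lambda>n. v + of_nat n \<noteq> 0) sequentially"
      using filterlim_at_infinity_imp_eventually_ne[OF inf, of 0] by simp
    hence "eventually (\<lambda>n. 1 + (u - v) / (v + of_nat n) = (u + of_nat n) / (v + of_nat n)) sequentially"
      by eventually_elim (simp add: divide_simps)
    ultimately show ?thesis
      by (simp add: tendsto_cong)
  qed
  have "(\<lambda>n. (a + of_nat n) / (c + of_nat n) * ((b + of_nat n) / (1 + of_nat n)) * x)
          \<longlonglongrightarrow> 1 * 1 * x"
    by (intro tendsto_mult lim1 tendsto_const)
  hence "q \<longlonglongrightarrow> x"
    by (simp add: q_def)
  hence "(\<lambda>n. norm (q n)) \<longlonglongrightarrow> norm x"
    by (rule tendsto_norm)
  moreover from x obtain r where r: "norm x < r" "r < 1"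
    using dense by blast
  ultimately have "eventually (\<lambda>n. norm (q n) < r) sequentially"
    by (auto dest: order_tendstoD)
  then obtain N where N: "\<And>n. n \<ge> N \<Longrightarrow> norm (q n) < r"
    by (auto simp: eventually_sequentially)
  have "summable f"
  proof (rule summable_ratio_test[OF r(2)])
    fix n assume "n \<ge> N"
    thus "norm (f (Suc n)) \<le> r * norm (f n)"
      using N[of n] by (auto simp: step norm_mult intro!: mult_right_mono)
  qed
  thus ?thesis
    by (simp add: f_def hypergeo_F_def summable_sums)
qed

end

theory Submission
  imports Defs "HOL-Complex_Analysis.Complex_Analysis"
begin

text \<open>
  Write \<open>x\<^sub>0 = 1/2 - \<surd>3/4\<close>, let \<open>f(a)\<close> be the hypergeometric value on the left and \<open>g(a)\<close> the
  product of powers and Gamma values on the right.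

  The shift \<open>a \<mapsto> a - 2\<close> changes the parameters \<open>(a, 1 - a; 5/4 - a/2)\<close> by \<open>(-2, +2; +1)\<close>. Any three
  hypergeometric series whose parameters differ by integers are linearly dependent over the
  rational functions. At the special point \<open>x\<^sub>0\<close>, and for \<open>c = 5/4 - a/2\<close>, the relation between
  \<open>f(a)\<close>, \<open>f(a - 2)\<close> and a third contiguous series loses its third term, so \<open>f(a) = R(a) f(a - 2)\<close>
  with a rational \<open>R\<close> (\<open>hypergeo_recurrence\<close>). The function \<open>g\<close> satisfies the same recurrence
  (\<open>closed_form_recurrence\<close>), by the functional equation of the Gamma function.

  Hence \<open>H = f/g\<close> has period 2 on the half-plane \<open>Re a < 5/4\<close>, where both functions are holomorphic
  and \<open>g\<close> has no zeros. A recurrence alone determines \<open>f\<close> only up to such a periodic factor; the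
  factor is shown to be constant by a growth argument in the style of Carlson's theorem
  (\<open>periodic_halfplane_constant\<close>). It needs \<open>H(a) = O(exp(k |Im a|))\<close> on a vertical strip with some
  \<open>k < \<pi>/2\<close>. For \<open>f\<close> this comes from comparison with a binomial series (\<open>norm_hypergeo_F_le\<close>): the
  point \<open>x\<^sub>0\<close> is so small that any \<open>k \<ge> ln (2/\<surd>3)\<close> will do, for instance \<open>k = 1\<close>. For \<open>1/g\<close> it comes from the fact
  that \<open>|\<Gamma>(z) / \<Gamma>(z + 1/6)|\<close> is largest on the real axis (\<open>norm_Gamma_quotient_le\<close>).

  The constant is found at \<open>a = 5/6\<close>. There \<open>5/4 - a/2 = a\<close>, so the hypergeometric series
  is a binomial series, and the Gamma values reduce by Legendre duplication; both sides equal
  \<open>(2 - \<surd>3)\<^sup>1\<^sup>/\<^sup>6 2\<^sup>1\<^sup>/\<^sup>3\<close>. Finally the recurrence carries the identity from the half-plane to all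
  admissible \<open>a\<close>.
\<close>

section \<open>Periodic functions of small growth\<close>

text \<open>
  Near a common zero \<open>z\<close>, dividing numerator and denominator by \<open>w - z\<close> removes the singularity of
  each, and the new denominator takes the value \<open>g'(z) \<noteq> 0\<close> there.
\<close>

lemma holomorphic_on_quotient_simple_zeros:
  fixes f g :: "complex \<Rightarrow> complex"
  assumes f: "f holomorphic_on S" and g: "g holomorphic_on S" and S: "open S"
    and zeros: "\<And>z. z \<in> S \<Longrightarrow> g z = 0 \<Longrightarrow> f z = 0 \<and> deriv g z \<noteq> 0"
  shows "(\<lambda>z. if g z = 0 then deriv f z / deriv g z else f z / g z) holomorphic_on S"
    (is "?q holomorphic_on S")
proof -
  have "\<exists>e>0. ?q holomorphic_on ball z e" if z: "z \<in> S" for z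
  proof (cases "g z = 0")
    case False
    have "open (S \<inter> g -` (- {0}))"
      by (intro continuous_open_preimage[OF holomorphic_on_imp_continuous_on[OF g] S]) auto
    with z False obtain e where e: "e > 0" "ball z e \<subseteq> (S \<inter> g -` (- {0}))"
      by (metis ComplI IntI open_contains_ball singletonD vimageI)
    have "(\<lambda>w. f w / g w) holomorphic_on ball z e"
      using e by (intro holomorphic_on_divide holomorphic_on_subset[OF f] holomorphic_on_subset[OF g]) auto
    hence "?q holomorphic_on ball z e"
      by (rule holomorphic_transform) (use e in auto)
    with e show ?thesis by blast
  next
    case True
    define F where "F = (\<lambda>w. if w = z then deriv f z else (f w - f z) / (w - z))"
    define G where "G = (\<lambda>w. if w = z then deriv g z else (g w - g z) / (w - z))"
    have F: "F holomorphic_on S" and G: "G holomorphic_on S"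
      unfolding F_def G_def by (intro pole_lemma_open f g S)+
    have z0: "f z = 0" "deriv g z \<noteq> 0" using zeros[OF z True] by auto
    have "open (S \<inter> G -` (- {0}))"
      by (intro continuous_open_preimage[OF holomorphic_on_imp_continuous_on[OF G] S]) auto
    moreover have "z \<in> (S \<inter> G -` (- {0}))" using z z0 by (simp add: G_def)
    ultimately obtain e where e: "e > 0" "ball z e \<subseteq> (S \<inter> G -` (- {0}))"
      by (meson open_contains_ball)
    have "(\<lambda>w. F w / G w) holomorphic_on ball z e"
      using e by (intro holomorphic_on_divide holomorphic_on_subset[OF F] holomorphic_on_subset[OF G]) auto
    moreover have "F w / G w = ?q w" if "w \<in> ball z e" for w
    proof -
      have "G w \<noteq> 0" using e that by auto
      thus ?thesis using True z0 by (auto simp: F_def G_def)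
    qed
    ultimately have "?q holomorphic_on ball z e"
      by (rule holomorphic_transform)
    with e show ?thesis by blast
  qed
  hence "?q analytic_on S" by (auto simp: analytic_on_def)
  thus ?thesis by (rule analytic_imp_holomorphic)
qed

lemma halfplane_periodic_int:
  fixes f :: "complex \<Rightarrow> 'a" and p c :: real
  assumes p: "p > 0" and per: "\<And>z. Re z < c \<Longrightarrow> f (z - of_real p) = f z"
    and zw: "Re z < c" "Re w < c" "w = z + of_int k * of_real p"
  shows "f w = f z"
proof -
  have nat: "f (z - of_nat n * of_real p) = f z" if "Re z < c" for n z
  proof (induction n)
    case (Suc n)
    have "Re (z - of_nat n * of_real p) < c" using that p
      by simp (smt (verit) mult_nonneg_nonneg of_nat_0_le_iff)
    from per[OF this] Suc show ?case by (simp add: algebra_simps)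
  qed simp
  show ?thesis
  proof (cases "k \<ge> 0")
    case True
    then obtain n where "k = int n" by (metis nat_0_le)
    with zw have "z = w - of_nat n * of_real p" by simp
    thus ?thesis using nat[OF zw(2)] by metis
  next
    case False
    then obtain n where "k = - int n" by (metis nat_0_le minus_minus neg_0_le_iff_le nle_le)
    with zw have "w = z - of_nat n * of_real p" by simp
    thus ?thesis using nat[OF zw(1)] by metis
  qed
qed

lemma norm_sin_ge: "(exp \<bar>Im z\<bar> - 1) / 2 \<le> norm (sin z)"
proof -
  have n: "norm (exp (\<i> * z)) = exp (- Im z)" "norm (exp (- (\<i> * z))) = exp (Im z)"
    by (simp_all add: norm_exp_eq_Re)
  have "sin z = (exp (\<i> * z) - exp (- (\<i> * z))) / (2 * \<i>)" by (rule sin_exp_eq)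
  hence "norm (sin z) = norm (exp (\<i> * z) - exp (- (\<i> * z))) / 2"
    by (simp add: norm_divide norm_mult)
  moreover have "\<bar>exp (- Im z) - exp (Im z)\<bar> \<le> norm (exp (\<i> * z) - exp (- (\<i> * z)))"
    unfolding n[symmetric] by (rule norm_triangle_ineq3)
  moreover have "exp \<bar>Im z\<bar> - 1 \<le> \<bar>exp (- Im z) - exp (Im z)\<bar>"
    by (cases "Im z \<ge> 0") (auto simp: abs_if)
  ultimately have "exp \<bar>Im z\<bar> - 1 \<le> 2 * norm (sin z)" by simp
  thus ?thesis by simp
qed

text \<open>
  A periodic variant of Carlson's theorem. The function \<open>f - f(w)\<close> vanishes at all translates of \<open>w\<close>
  by multiples of \<open>p\<close>, and these are exactly the zeros, all of them simple, of
  \<open>s(z) = sin (\<pi> (z - w) / p)\<close>. So \<open>q = (f - f(w)) / s\<close> is holomorphic. Its modulus has period \<open>p\<close>,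
  and in the strip it tends to 0 at both ends, because \<open>|s|\<close> grows like \<open>exp (\<pi> |Im z| / p)\<close> while
  \<open>f\<close> grows more slowly. Therefore \<open>|q|\<close> attains its maximum on the half-plane, and the
  maximum principle forces \<open>q = 0\<close>.
\<close>

lemma periodic_halfplane_constant:
  fixes f :: "complex \<Rightarrow> complex" and p c d k C :: real
  assumes f: "f holomorphic_on {z. Re z < c}" and p: "p > 0"
    and per: "\<And>z. Re z < c \<Longrightarrow> f (z - of_real p) = f z"
    and d: "d + p < c" and k: "k < pi / p"
    and bound: "\<And>z. Re z \<in> {d..d+p} \<Longrightarrow> norm (f z) \<le> C * exp (k * \<bar>Im z\<bar>)"
    and zw: "Re z < c" "Re w < c"
  shows "f z = f w"
proof -
  define S where "S = {z. Re z < c}"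
  have S: "open S" "connected S"
    by (auto simp: S_def open_halfspace_Re_lt intro!: convex_connected convex_halfspace_Re_lt)
  define \<beta> where "\<beta> = pi / p"
  have \<beta>: "\<beta> > 0" "\<beta> * p = pi" using p by (auto simp: \<beta>_def)
  define s where "s = (\<lambda>z. sin (of_real \<beta> * (z - w)))"
  define g where "g = (\<lambda>z. f z - f w)"
  define q where "q = (\<lambda>z. if s z = 0 then deriv g z / deriv s z else g z / s z)"
  have s': "(s has_field_derivative (of_real \<beta> * cos (of_real \<beta> * (z - w)))) (at z)" for z
    unfolding s_def by (auto intro!: derivative_eq_intros)
  have shol: "s holomorphic_on S" unfolding s_def by (intro holomorphic_intros)
  have ghol: "g holomorphic_on S" unfolding g_def using f by (auto simp: S_def intro!: holomorphic_intros)
  have g0: "g z = 0" if z: "Re z < c" "s z = 0" for z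
  proof -
    obtain n :: int where "of_real \<beta> * (z - w) = of_real (n * pi)"
      using z by (auto simp: s_def sin_eq_0)
    also have "\<dots> = of_real \<beta> * (of_int n * of_real p)"
      unfolding \<beta>(2)[symmetric] by (simp add: mult_ac)
    finally have "z - w = of_int n * of_real p" using \<beta> by simp
    hence "z = w + of_int n * of_real p" by (simp add: algebra_simps)
    with z zw have "f z = f w"
      using halfplane_periodic_int[of p c f w z n] p per by blast
    thus ?thesis by (simp add: g_def)
  qed
  have qhol: "q holomorphic_on S" unfolding q_def
  proof (intro holomorphic_on_quotient_simple_zeros shol ghol S conjI)
    fix z assume z: "z \<in> S" "s z = 0"
    thus "g z = 0" by (simp add: g0 S_def)
    have "cos (of_real \<beta> * (z - w)) \<noteq> 0"
      using z sin_cos_squared_add[of "of_real \<beta> * (z - w)"] by (auto simp: s_def)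
    thus "deriv s z \<noteq> 0" using \<beta> DERIV_imp_deriv[OF s'] by simp
  qed
  have \<beta>p: "of_real \<beta> * (z - of_real p - w) = of_real \<beta> * (z - w) - of_real pi" for z
    unfolding \<beta>(2)[symmetric] by (simp add: algebra_simps)
  have qper: "norm (q (z - of_real p)) = norm (q z)" if z: "Re z < c" for z
  proof -
    have 1: "s (z - of_real p) = - s z" for z
      unfolding s_def \<beta>p by (simp add: sin_diff)
    have 2: "deriv s (z - of_real p) = - deriv s z"
      unfolding DERIV_imp_deriv[OF s'] \<beta>p by (simp add: cos_diff)
    have 3: "g (z - of_real p) = g z" using per[OF z] by (simp add: g_def)
    have zS: "z - of_real p \<in> S" "z \<in> S" using z p by (auto simp: S_def)
    have "(g has_field_derivative deriv g (z - of_real p)) (at (z + - of_real p))"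
      using holomorphic_derivI[OF ghol S(1) zS(1)] by simp
    hence "((\<lambda>z. g (z + - of_real p)) has_field_derivative deriv g (z - of_real p)) (at z)"
      by (subst (asm) DERIV_shift)
    hence "(g has_field_derivative deriv g (z - of_real p)) (at z)"
      by (rule has_field_derivative_transform_within_open[OF _ S(1) zS(2)]) (auto simp: g_def S_def per)
    hence 4: "deriv g (z - of_real p) = deriv g z" by (simp add: DERIV_imp_deriv)
    show ?thesis unfolding q_def 1 2 3 4 by (simp add: norm_divide)
  qed
  have strip: "\<exists>z'. Re z' \<in> {d..d+p} \<and> norm (q z') = norm (q z)" if z: "Re z < c" for z
  proof -
    define m where "m = \<lfloor>(Re z - d) / p\<rfloor>"
    define z' where "z' = z + of_int (-m) * of_real p"
    have "of_int m \<le> (Re z - d) / p" "(Re z - d) / p < of_int m + 1" unfolding m_def by linarith+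
    hence "Re z' \<in> {d..d+p}" using p by (auto simp: z'_def field_simps)
    moreover have "norm (q z') = norm (q z)"
      using halfplane_periodic_int[of p c "\<lambda>z. norm (q z)" z z' "-m"] calculation d p qper z
      by (auto simp: z'_def)
    ultimately show ?thesis by blast
  qed
  \<comment> \<open>The majorant of \<open>|q|\<close> at height \<open>t\<close>: the bound for the numerator over the lower bound for the sine.\<close>
  define h where "h = (\<lambda>t. (C * exp (k * t) + norm (f w)) / ((exp (\<beta> * (t - \<bar>Im w\<bar>)) - 1) / 2))"
  have hlim: "(h \<longlongrightarrow> 0) at_top"
  proof -
    have e: "((\<lambda>t. exp (- r * t)) \<longlongrightarrow> 0) at_top" if "r > 0" for r :: real
      using that by real_asymp
    note e1 = e[of "\<beta> - k"] and e2 = e[of \<beta>]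
    have "((\<lambda>t. (C * exp (-(\<beta> - k) * t) + norm (f w) * exp (-\<beta> * t)) / ((exp (-\<beta> * \<bar>Im w\<bar>) - exp (-\<beta> * t)) / 2)) \<longlongrightarrow>
       (C * 0 + norm (f w) * 0) / ((exp (-\<beta> * \<bar>Im w\<bar>) - 0) / 2)) at_top"
      using \<beta> k by (intro tendsto_intros e1 e2) (auto simp: \<beta>_def)
    also have "(\<lambda>t. (C * exp (-(\<beta> - k) * t) + norm (f w) * exp (-\<beta> * t)) / ((exp (-\<beta> * \<bar>Im w\<bar>) - exp (-\<beta> * t)) / 2)) = h"
    proof
      fix t
      have "exp (-(\<beta> - k) * t) = exp (k * t) * exp (-\<beta> * t)" by (simp add: algebra_simps flip: exp_add)
      moreover have "exp (-\<beta> * \<bar>Im w\<bar>) = exp (\<beta> * (t - \<bar>Im w\<bar>)) * exp (-\<beta> * t)"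
        by (simp add: algebra_simps flip: exp_add)
      ultimately have "(C * exp (-(\<beta> - k) * t) + norm (f w) * exp (-\<beta> * t)) = (C * exp (k * t) + norm (f w)) * exp (-\<beta> * t)"
        "(exp (-\<beta> * \<bar>Im w\<bar>) - exp (-\<beta> * t)) / 2 = (exp (\<beta> * (t - \<bar>Im w\<bar>)) - 1) / 2 * exp (-\<beta> * t)"
        by (simp_all add: algebra_simps diff_divide_distrib)
      thus "(C * exp (-(\<beta> - k) * t) + norm (f w) * exp (-\<beta> * t)) / ((exp (-\<beta> * \<bar>Im w\<bar>) - exp (-\<beta> * t)) / 2) = h t"
        unfolding h_def by (simp only: nonzero_mult_divide_mult_cancel_right[OF exp_not_eq_zero])
    qed
    finally show ?thesis by simp
  qed
  have qh: "norm (q z) \<le> h \<bar>Im z\<bar>" if z: "Re z \<in> {d..d+p}" "\<bar>Im z\<bar> > \<bar>Im w\<bar>" for z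
  proof -
    have "\<bar>Im (of_real \<beta> * (z - w))\<bar> = \<beta> * \<bar>Im z - Im w\<bar>" using \<beta> by (simp add: abs_mult)
    also have "\<dots> \<ge> \<beta> * (\<bar>Im z\<bar> - \<bar>Im w\<bar>)" using \<beta> by (intro mult_left_mono) auto
    finally have "(exp (\<beta> * (\<bar>Im z\<bar> - \<bar>Im w\<bar>)) - 1) / 2 \<le> (exp \<bar>Im (of_real \<beta> * (z - w))\<bar> - 1) / 2" by simp
    also have "\<dots> \<le> norm (s z)" unfolding s_def by (rule norm_sin_ge)
    finally have s: "(exp (\<beta> * (\<bar>Im z\<bar> - \<bar>Im w\<bar>)) - 1) / 2 \<le> norm (s z)" .
    have pos: "0 < (exp (\<beta> * (\<bar>Im z\<bar> - \<bar>Im w\<bar>)) - 1) / 2" using z \<beta> by simp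
    with s have "s z \<noteq> 0" by auto
    hence "norm (q z) = norm (g z) / norm (s z)" by (simp add: q_def norm_divide)
    also have "norm (g z) \<le> norm (f z) + norm (f w)" unfolding g_def by (rule norm_triangle_ineq4)
    also have "norm (f z) \<le> C * exp (k * \<bar>Im z\<bar>)" by (rule bound[OF z(1)])
    finally have *: "norm (q z) \<le> (C * exp (k * \<bar>Im z\<bar>) + norm (f w)) / norm (s z)"
      by (simp add: divide_right_mono)
    have "norm (f z) \<le> C * exp (k * \<bar>Im z\<bar>)" by (rule bound[OF z(1)])
    hence "0 \<le> C * exp (k * \<bar>Im z\<bar>)" using norm_ge_zero order_trans by blast
    thus ?thesis unfolding h_def using s pos
      by (intro order_trans[OF *] divide_left_mono mult_pos_pos) auto
  qed
  have "q z = 0" if z: "Re z < c" for z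
  proof (rule ccontr)
    assume "q z \<noteq> 0"
    from strip[OF z] obtain a where a: "Re a \<in> {d..d+p}" "norm (q a) = norm (q z)" by blast
    define \<epsilon> where "\<epsilon> = norm (q a)"
    have \<epsilon>: "\<epsilon> > 0" using \<open>q z \<noteq> 0\<close> a by (simp add: \<epsilon>_def)
    have "eventually (\<lambda>t. h t < \<epsilon>) at_top" using order_tendstoD(2)[OF hlim \<epsilon>] .
    then obtain Y0 where Y0: "\<And>t. t \<ge> Y0 \<Longrightarrow> h t < \<epsilon>" by (auto simp: eventually_at_top_linorder)
    define Y where "Y = max Y0 (\<bar>Im w\<bar> + 1)"
    have far: "norm (q b) < \<epsilon>" if "Re b \<in> {d..d+p}" "\<bar>Im b\<bar> \<ge> Y" for b
      using qh[of b] Y0[of "\<bar>Im b\<bar>"] that by (auto simp: Y_def)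
    define K where "K = cbox (Complex d (-Y)) (Complex (d+p) Y)"
    have K: "b \<in> K \<longleftrightarrow> Re b \<in> {d..d+p} \<and> \<bar>Im b\<bar> \<le> Y" for b
      by (auto simp: K_def in_cbox_complex_iff)
    have KS: "K \<subseteq> S" using K d by (auto simp: S_def)
    have aK: "a \<in> K" unfolding K using a far[of a] by (cases "\<bar>Im a\<bar> \<le> Y") (auto simp: \<epsilon>_def)
    have "\<exists>b\<in>K. \<forall>y\<in>K. norm (q y) \<le> norm (q b)"
      using aK by (intro continuous_attains_sup continuous_on_norm
         holomorphic_on_imp_continuous_on[OF holomorphic_on_subset[OF qhol KS]]) (auto simp: K_def)
    then obtain b where b: "b \<in> K" "\<And>y. y \<in> K \<Longrightarrow> norm (q y) \<le> norm (q b)" by blast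
    have \<epsilon>b: "\<epsilon> \<le> norm (q b)" using b(2)[OF aK] by (simp add: \<epsilon>_def)
    have max: "norm (q y) \<le> norm (q b)" if y: "y \<in> S" for y
    proof -
      obtain y' where "Re y' \<in> {d..d+p}" "norm (q y') = norm (q y)" using strip[of y] y unfolding S_def by blast
      thus ?thesis using b(2)[of y'] far[of y'] \<epsilon>b by (cases "\<bar>Im y'\<bar> \<le> Y") (auto simp: K)
    qed
    have "q constant_on S"
      by (rule maximum_modulus_principle[OF qhol S S(1) order_refl _ max]) (use b KS in auto)
    moreover have "Complex d Y \<in> S" using d p by (simp add: S_def)
    ultimately have "q (Complex d Y) = q b" using b KS by (auto simp: constant_on_def)
    moreover have "norm (q (Complex d Y)) < \<epsilon>" using p by (intro far) (auto simp: Y_def)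
    ultimately show False using \<epsilon>b by simp
  qed
  from this[OF zw(1)] have "q z = 0" .
  show ?thesis
  proof (cases "s z = 0")
    case True
    hence "g z = 0" by (rule g0[OF zw(1)])
    thus ?thesis by (simp add: g_def)
  next
    case False
    thus ?thesis using \<open>q z = 0\<close> by (simp add: q_def g_def)
  qed
qed

section \<open>Gamma quotients\<close>

lemma Re_pos_notin_nonpos_Ints: "Re z > 0 \<Longrightarrow> z \<notin> \<int>\<^sub>\<le>\<^sub>0"
  by (auto elim!: nonpos_Ints_cases)

text \<open>
  In Euler's limit formula the quotient \<open>\<Gamma>(z) / \<Gamma>(z + r)\<close> is a positive factor times the product of
  the terms \<open>(z + r + k) / (z + k) = 1 + r / (z + k)\<close>, and each of these is largest in modulus when \<open>z\<close>
  is replaced by its real part.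
\<close>

lemma norm_Gamma_quotient_le:
  fixes z :: complex and r :: real
  assumes z: "Re z > 0" and r: "r \<ge> 0"
  shows "norm (Gamma z / Gamma (z + of_real r)) \<le> Gamma (Re z) / Gamma (Re z + r)"
proof (rule LIMSEQ_le)
  define x where "x = Re z"
  have G: "Gamma (z + of_real r) \<noteq> 0" "Gamma (x + r) \<noteq> 0"
  proof -
    have "Re (z + of_real r) > 0" "x + r > 0" using z r by (auto simp: x_def)
    thus "Gamma (z + of_real r) \<noteq> 0" "Gamma (x + r) \<noteq> 0"
      by (auto simp del: plus_complex.sel simp: Gamma_eq_zero_iff elim!: nonpos_Ints_cases)
  qed
  show "(\<lambda>n. norm (Gamma_series z n / Gamma_series (z + of_real r) n)) \<longlonglongrightarrow> norm (Gamma z / Gamma (z + of_real r))"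
    by (intro tendsto_intros G)
  show "(\<lambda>n. Gamma_series (Re z) n / Gamma_series (Re z + r) n) \<longlonglongrightarrow> Gamma (Re z) / Gamma (Re z + r)"
    using G by (intro tendsto_intros) (auto simp: x_def)
  have *: "norm (pochhammer (z + of_real r) n) / norm (pochhammer z n) \<le> pochhammer (x + r) n / pochhammer x n" for n
  proof -
    have "norm (z + of_real r + of_nat k) / norm (z + of_nat k) \<le> (x + r + of_nat k) / (x + of_nat k)" for k
    proof -
      have x: "x + of_nat k > 0" using z by (simp add: x_def)
      have le: "x + of_nat k \<le> norm (z + of_nat k)" using complex_Re_le_cmod[of "z + of_nat k"] by (simp add: x_def)
      have nz: "norm (z + of_nat k) \<noteq> 0" using le x by linarith
      have "norm (z + of_real r + of_nat k) \<le> norm (z + of_nat k) + norm (of_real r :: complex)"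
        by (metis add.assoc add.commute norm_triangle_ineq)
      hence "norm (z + of_real r + of_nat k) / norm (z + of_nat k) \<le> (norm (z + of_nat k) + r) / norm (z + of_nat k)"
        using r by (intro divide_right_mono) auto
      also have "\<dots> = 1 + r / norm (z + of_nat k)" using nz by (simp add: add_divide_distrib)
      also have "\<dots> \<le> 1 + r / (x + of_nat k)" using le x r by (intro add_left_mono divide_left_mono mult_pos_pos) auto
      also have "\<dots> = (x + r + of_nat k) / (x + of_nat k)" using x by (simp add: field_simps)
      finally show ?thesis .
    qed
    hence "(\<Prod>k<n. norm (z + of_real r + of_nat k) / norm (z + of_nat k)) \<le> (\<Prod>k<n. (x + r + of_nat k) / (x + of_nat k))"
      by (intro prod_mono) auto
    thus ?thesis by (simp add: pochhammer_prod prod_norm[symmetric] prod_dividef lessThan_atLeast0)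
  qed
  show "\<exists>N. \<forall>n\<ge>N. norm (Gamma_series z n / Gamma_series (z + of_real r) n) \<le> Gamma_series (Re z) n / Gamma_series (Re z + r) n"
  proof (intro exI[of _ 1] allI impI)
    fix n :: nat assume n: "n \<ge> 1"
    have "Gamma_series z n / Gamma_series (z + of_real r) n = exp (- of_real (r * ln n)) * (pochhammer (z + of_real r) (Suc n) / pochhammer z (Suc n))"
    proof -
      have "exp ((z + of_real r) * of_real (ln n)) = exp (z * of_real (ln n)) * exp (of_real (r * ln n))"
        by (simp add: distrib_right exp_add)
      thus ?thesis by (simp add: Gamma_series_def exp_minus divide_inverse mult_ac)
    qed
    hence "norm (Gamma_series z n / Gamma_series (z + of_real r) n) = exp (- r * ln n) * (norm (pochhammer (z + of_real r) (Suc n)) / norm (pochhammer z (Suc n)))"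
      by (simp only: norm_mult norm_divide norm_exp_eq_Re) simp
    also have "\<dots> \<le> exp (- r * ln n) * (pochhammer (x + r) (Suc n) / pochhammer x (Suc n))"
      by (intro mult_left_mono *) auto
    also have "\<dots> = Gamma_series (Re z) n / Gamma_series (Re z + r) n"
    proof -
      have "exp ((x + r) * ln n) = exp (x * ln n) * exp (r * ln n)"
        by (simp add: distrib_right exp_add)
      thus ?thesis by (simp add: Gamma_series_def exp_minus divide_inverse mult_ac flip: x_def)
    qed
    finally show "norm (Gamma_series z n / Gamma_series (z + of_real r) n) \<le> Gamma_series (Re z) n / Gamma_series (Re z + r) n" .
  qed
qed

section \<open>Hypergeometric series as holomorphic functions of the parameter\<close>

lemma gbinomial_neg_times_power:
  fixes b z :: "'a :: field_char_0"
  shows "((- b) gchoose n) * (- z) ^ n = pochhammer b n / fact n * z ^ n"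
proof -
  have "(- 1) ^ n * (- z) ^ n = z ^ n" by (simp flip: power_mult_distrib)
  thus ?thesis by (simp add: gbinomial_pochhammer mult_ac)
qed

lemma pochhammer_binomial_sums:
  fixes b z :: complex
  assumes "norm z < 1"
  shows "(\<lambda>n. pochhammer b n / fact n * z ^ n) sums ((1 - z) powr (- b))"
  using gen_binomial_complex[of "- z" "- b"] assms by (simp add: gbinomial_neg_times_power)

lemma pochhammer_binomial_sums_real:
  fixes b z :: real
  assumes "\<bar>z\<bar> < 1"
  shows "(\<lambda>n. pochhammer b n / fact n * z ^ n) sums ((1 - z) powr (- b))"
  using gen_binomial_real[of "- z" "- b"] assms by (simp add: gbinomial_neg_times_power)

lemma hypergeo_F_cancel:
  assumes "a \<notin> \<int>\<^sub>\<le>\<^sub>0" "norm x < 1"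
  shows "hypergeo_F a b a x = (1 - x) powr (- b)"
proof -
  have nz: "pochhammer a n \<noteq> 0" for n
    using assms(1) by (auto dest: pochhammer_eq_0_imp_nonpos_Int)
  have "(\<lambda>n. pochhammer b n / fact n * x ^ n) sums hypergeo_F a b a x"
    using hypergeo_F_sums[OF assms(2), of a b a] by (simp add: nz pochhammer_fact)
  thus ?thesis using pochhammer_binomial_sums[OF assms(2)] by (rule sums_unique2)
qed

lemma norm_pochhammer_le: "norm (pochhammer z n) \<le> pochhammer (norm z) n"
  for z :: complex
  unfolding pochhammer_prod prod_norm[symmetric]
  by (intro prod_mono conjI norm_ge_zero order_trans[OF norm_triangle_ineq]) simp

lemma norm_pochhammer_le_power_mult:
  fixes a c :: complex
  assumes "\<And>k. norm (a + of_nat k) \<le> K * norm (c + of_nat k)"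
  shows "norm (pochhammer a n) \<le> K ^ n * norm (pochhammer c n)"
proof -
  have "(\<Prod>k<n. norm (a + of_nat k)) \<le> (\<Prod>k<n. K * norm (c + of_nat k))"
    by (intro prod_mono conjI assms) auto
  thus ?thesis by (simp add: pochhammer_prod prod_norm[symmetric] prod.distrib lessThan_atLeast0)
qed

text \<open>
  With \<open>c = 5/4 - a/2\<close>, the numbers \<open>a + k\<close> and \<open>2 (c + k)\<close> have imaginary parts of the same size, and for
  \<open>Re a \<le> 5/4\<close> the real part of the second has the larger modulus. So \<open>|(a, n) / (c, n)| \<le> 2\<^sup>n\<close>, uniformly in
  \<open>Im a\<close>. Since \<open>|(1 - a, n)| \<le> (|1 - a|, n)\<close>, the general term of the binomial series of
  \<open>(1 - 2 |x|)\<close> to the power \<open>- |1 - a|\<close> is a majorant.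
\<close>

lemma hypergeo_term_bound:
  assumes a: "Re a \<le> 5/4"
  shows "norm (pochhammer a n * pochhammer (1-a) n / (pochhammer (5/4 - a/2) n * pochhammer 1 n) * x ^ n)
     \<le> pochhammer (norm (1-a)) n / fact n * (2 * norm x) ^ n"
proof -
  define c where "c = 5/4 - a/2"
  have "norm (a + of_nat k) \<le> 2 * norm (c + of_nat k)" for k
  proof -
    have "\<bar>Re (a + of_nat k)\<bar> \<le> \<bar>Re (2 * (c + of_nat k))\<bar>" "\<bar>Im (a + of_nat k)\<bar> \<le> \<bar>Im (2 * (c + of_nat k))\<bar>"
      using a by (simp_all add: c_def)
    hence "norm (a + of_nat k) \<le> norm (2 * (c + of_nat k))"
      unfolding cmod_def by (intro real_sqrt_le_mono add_mono) (simp_all only: abs_le_square_iff)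
    thus ?thesis by (simp only: norm_mult norm_numeral)
  qed
  hence 1: "norm (pochhammer a n) \<le> 2 ^ n * norm (pochhammer c n)"
    by (rule norm_pochhammer_le_power_mult)
  have "norm (pochhammer a n) / norm (pochhammer c n) \<le> 2 ^ n"
    using 1 by (cases "pochhammer c n = 0") (simp_all add: divide_simps)
  hence "norm (pochhammer a n) / norm (pochhammer c n) * (norm (pochhammer (1-a) n) / fact n * norm x ^ n)
     \<le> 2 ^ n * (pochhammer (norm (1-a)) n / fact n * norm x ^ n)"
    using order_trans[OF norm_ge_zero norm_pochhammer_le[of "1-a" n]]
    by (intro mult_mono divide_right_mono norm_pochhammer_le) auto
  thus ?thesis
    by (simp add: norm_mult norm_divide norm_power pochhammer_fact[symmetric] c_def power_mult_distrib mult_ac)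
qed

lemma norm_hypergeo_F_le:
  assumes a: "Re a \<le> 5/4" and x: "2 * norm x < 1"
  shows "norm (hypergeo_F a (1-a) (5/4 - a/2) x) \<le> (1 - 2 * norm x) powr (- norm (1 - a))"
proof -
  have b: "(\<lambda>n. pochhammer (norm (1-a)) n / fact n * (2 * norm x) ^ n) sums ((1 - 2 * norm x) powr (- norm (1-a)))"
    by (intro pochhammer_binomial_sums_real) (use x in auto)
  show ?thesis unfolding hypergeo_F_def sums_unique[OF b]
    by (intro norm_suminf_le hypergeo_term_bound a sums_summable[OF b])
qed

lemma holomorphic_on_pochhammer [holomorphic_intros]:
  "f holomorphic_on A \<Longrightarrow> (\<lambda>z. pochhammer (f z) n :: complex) holomorphic_on A"
  unfolding pochhammer_prod by (intro holomorphic_intros)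

lemma pochhammer_mono: "0 \<le> x \<Longrightarrow> x \<le> y \<Longrightarrow> pochhammer x n \<le> pochhammer (y::real) n"
  unfolding pochhammer_prod by (intro prod_mono) auto

lemma holomorphic_hypergeo_F:
  assumes x: "2 * norm x < 1"
  shows "(\<lambda>a. hypergeo_F a (1-a) (5/4 - a/2) x) holomorphic_on {a. Re a < 5/4}"
    (is "?F holomorphic_on ?S")
proof (rule holomorphic_uniform_sequence)
  define t where "t = (\<lambda>n a. pochhammer a n * pochhammer (1-a) n / (pochhammer (5/4 - a/2) n * pochhammer 1 n) * x ^ n)"
  show S: "open ?S" by (rule open_halfspace_Re_lt)
  have "pochhammer (5/4 - a/2) n \<noteq> 0" if "Re a < 5/4" for a n
  proof
    assume "pochhammer (5/4 - a/2) n = 0"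
    then obtain k where "5/4 - a/2 = - of_nat k" by (auto simp: pochhammer_eq_0_iff)
    hence "Re (5/4 - a/2) = Re (- of_nat k)" by simp
    thus False using that by simp
  qed
  moreover have "pochhammer 1 n \<noteq> (0::complex)" for n by (simp add: pochhammer_fact[symmetric])
  ultimately show "(\<lambda>a. \<Sum>n<N. t n a) holomorphic_on ?S" for N
    unfolding t_def by (intro holomorphic_intros) auto
  fix a assume "a \<in> ?S"
  with S obtain d where d: "d > 0" "cball a d \<subseteq> ?S" by (meson open_contains_cball)
  define M where "M = norm (1 - a) + d"
  have "uniform_limit (cball a d) (\<lambda>N a. \<Sum>n<N. t n a) (\<lambda>a. \<Sum>n. t n a) sequentially"
  proof (rule Weierstrass_m_test)
    show "summable (\<lambda>n. pochhammer M n / fact n * (2 * norm x) ^ n)"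
      by (intro sums_summable[OF pochhammer_binomial_sums_real]) (use x in auto)
    fix n z assume z: "z \<in> cball a d"
    have "norm (1 - z) \<le> norm (1 - a) + norm (a - z)" by norm
    also have "\<dots> \<le> M" using z by (simp add: M_def dist_norm)
    finally have "pochhammer (norm (1-z)) n / fact n * (2 * norm x) ^ n \<le> pochhammer M n / fact n * (2 * norm x) ^ n"
      by (intro mult_right_mono divide_right_mono pochhammer_mono) auto
    moreover have "norm (t n z) \<le> pochhammer (norm (1-z)) n / fact n * (2 * norm x) ^ n"
      unfolding t_def by (rule hypergeo_term_bound) (use z d in auto)
    ultimately show "norm (t n z) \<le> pochhammer M n / fact n * (2 * norm x) ^ n" by linarith
  qed
  thus "\<exists>d>0. cball a d \<subseteq> ?S \<and> uniform_limit (cball a d) (\<lambda>N a. \<Sum>n<N. t n a) ?F sequentially"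
    using d unfolding t_def hypergeo_F_def by blast
qed

section \<open>The shift by two\<close>

lemma sqrt3_lt_2: "sqrt 3 < 2"
  by (rule real_less_lsqrt) auto

lemma norm_evaluation_point: "2 * norm (1/2 - 1/4 * complex_of_real (sqrt 3)) = 1 - sqrt 3 / 2"
proof -
  have "1/2 - 1/4 * complex_of_real (sqrt 3) = of_real (1/2 - 1/4 * sqrt 3)" by simp
  hence "norm (1/2 - 1/4 * complex_of_real (sqrt 3)) = \<bar>1/2 - 1/4 * sqrt 3\<bar>"
    by (simp only: norm_of_real)
  thus ?thesis using sqrt3_lt_2 by simp
qed

lemma norm_evaluation_point_less_1: "norm (1/2 - 1/4 * complex_of_real (sqrt 3)) < 1"
proof -
  have "0 < sqrt 3" by simp
  with norm_evaluation_point show ?thesis by linarith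
qed

text \<open>
  This is creative telescoping in the style of Zeilberger. With \<open>t n\<close> and \<open>t' n\<close> the terms of the two
  series, \<open>t n - R t' n\<close> is a difference \<open>G (n - 1) - G (n - 2)\<close> of a hypergeometric sequence \<open>G\<close> that
  tends to 0. All terms with \<open>n \<ge> 2\<close> are polynomial multiples of the sequence \<open>b\<close>, whose
  Pochhammer symbols \<open>(a, m)\<close> and \<open>(3 - a, m)\<close> are common to both series after the index shift
  \<open>n = m + 2\<close>; this avoids division by factors such as \<open>a + m\<close> that may vanish.
\<close>

lemma hypergeo_recurrence:
  fixes a :: complex
  defines "x0 \<equiv> 1/2 - 1/4 * of_real (sqrt 3)"
  assumes "5/4 - a/2 \<notin> \<int>\<^sub>\<le>\<^sub>0"
  shows "hypergeo_F a (1 - a) (5/4 - a/2) x0 =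
    (2 - of_real (sqrt 3)) * (3 * of_real (sqrt 3)) * (13/12 - a/2) / (5/4 - a/2) *
    hypergeo_F (a-2) (1 - (a-2)) (5/4 - (a-2)/2) x0"
proof -
  define s :: complex where "s = of_real (sqrt 3)"
  have s2: "s * s = 3" by (simp add: s_def flip: of_real_mult)
  have "s * s * y = 3 * y" for y by (simp add: s2)
  hence ss: "s * (s * y) = 3 * y" for y by (simp add: mult.assoc)
  define c where "c = 5/4 - a/2"
  have c: "c + of_nat k \<noteq> 0" for k
    using assms(2) plus_of_nat_eq_0_imp[of c k] unfolding c_def by blast
  define R where "R = (2 - s) * (3 * s) * (13/12 - a/2) / c"
  define t where "t = (\<lambda>n. pochhammer a n * pochhammer (1-a) n / (pochhammer c n * pochhammer 1 n) * x0 ^ n)"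
  define t' where "t' = (\<lambda>n. pochhammer (a-2) n * pochhammer (3-a) n / (pochhammer (c+1) n * pochhammer 1 n) * x0 ^ n)"
  define b where "b = (\<lambda>m. pochhammer a m * pochhammer (3-a) m / (pochhammer c (m+3) * fact (m+2)) * x0 ^ m)"
  \<comment> \<open>The factor \<open>(c + m + 2) (m + 2)\<close> of \<open>G\<close> cancels the denominator of \<open>b (m + 1) / b m\<close>. The other
      factor \<open>p\<close> must then be linear in \<open>m\<close>: its leading coefficient \<open>-1 / (1 - x0)\<close> comes from comparing
      the coefficients of \<open>m\<^sup>3\<close> in the telescoping equation, and evaluating that equation at
      \<open>m = - a\<close> gives its value there in terms of \<open>R\<close>. That all other coefficients agree is the
      special property of this \<open>c\<close> and \<open>x0\<close>.\<close>
  define p where "p = (\<lambda>m. (2 - s) * (2 * s * (3 - 2*a) - 4 * (of_nat m + a)))"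
  define G where "G = (\<lambda>m. (a-1)*(a-2)*x0^2 * (c + of_nat m + 2) * (of_nat m + 2) * p m * b m)"
  have t: "t (m+2) = (a-1)*(a-2)*(a + of_nat m)*(a + of_nat m+1)*(c + of_nat m+2)*x0^2 * b m" for m
  proof -
    have 1: "pochhammer a (m+2) = pochhammer a m * (a + of_nat m)*(a + of_nat m+1)"
      by (simp add: numeral_2_eq_2 pochhammer_Suc algebra_simps)
    have 2: "pochhammer (1-a) (m+2) = (1-a)*(2-a)*pochhammer (3-a) m"
      using pochhammer_product'[of "1-a" 2 m] by (simp add: numeral_2_eq_2 pochhammer_Suc algebra_simps)
    have 3: "pochhammer c (m+3) = pochhammer c (m+2) * (c + of_nat m+2)"
      using pochhammer_Suc[of c "m+2"] by (simp add: numeral_3_eq_3 algebra_simps)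
    have nz: "c + of_nat m + 2 \<noteq> 0" using c[of "m+2"] by (simp add: algebra_simps)
    have "t (m+2) = pochhammer a m * (a + of_nat m)*(a + of_nat m+1) * ((1-a)*(2-a)*pochhammer (3-a) m)
       / (pochhammer c (m+2) * fact (m+2)) * (x0 ^ m * x0^2)"
      unfolding t_def 1 2 by (simp add: pochhammer_fact[symmetric] power_add power2_eq_square)
    also have "\<dots> = (a-1)*(a-2)*(a + of_nat m)*(a + of_nat m+1)*(c + of_nat m+2)*x0^2 * b m"
      unfolding b_def 3 using nz by (simp add: divide_simps) (simp add: algebra_simps power2_eq_square)
    finally show ?thesis .
  qed
  have t': "t' (m+2) = (a-1)*(a-2)*(3-a + of_nat m)*(4-a + of_nat m)*c*x0^2 * b m" for m
  proof -
    have 1: "pochhammer (3-a) (m+2) = pochhammer (3-a) m * (3-a + of_nat m)*(4-a + of_nat m)"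
      by (simp add: numeral_2_eq_2 pochhammer_Suc algebra_simps)
    have 2: "pochhammer (a-2) (m+2) = (a-2)*(a-1)*pochhammer a m"
      using pochhammer_product'[of "a-2" 2 m] by (simp add: numeral_2_eq_2 pochhammer_Suc algebra_simps)
    have 3: "pochhammer c (m+3) = c * pochhammer (c+1) (m+2)"
      using pochhammer_rec[of c "m+2"] by (simp add: numeral_3_eq_3 algebra_simps)
    have nz: "c \<noteq> 0" using c[of 0] by (simp add: algebra_simps)
    have "t' (m+2) = pochhammer (3-a) m * (3-a + of_nat m)*(4-a + of_nat m) * ((a-2)*(a-1)*pochhammer a m)
       / (pochhammer (c+1) (m+2) * fact (m+2)) * (x0 ^ m * x0^2)"
      unfolding t'_def 1 2 by (simp add: pochhammer_fact[symmetric] power_add power2_eq_square)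
    also have "\<dots> = (a-1)*(a-2)*(3-a + of_nat m)*(4-a + of_nat m)*c*x0^2 * b m"
      unfolding b_def 3 using nz by (simp add: divide_simps)
    finally show ?thesis .
  qed
  have b: "b (Suc m) * ((c + of_nat m+3) * (of_nat m+3)) = (a + of_nat m)*(3-a + of_nat m)*x0 * b m" for m
  proof -
    have nz: "c + of_nat m + 3 \<noteq> 0" using c[of "m+3"] by (simp add: algebra_simps)
    have nz2: "(of_nat m + 3::complex) \<noteq> 0" by (metis of_nat_numeral of_nat_add of_nat_eq_0_iff add_eq_0_iff_both_eq_0 zero_neq_numeral)
    have 3: "pochhammer c (Suc m+3) = pochhammer c (m+3) * (c + of_nat m+3)"
      using pochhammer_Suc[of c "m+3"] by (simp add: algebra_simps)
    have 4: "fact (Suc m+2) = fact (m+2) * (of_nat m+3 :: complex)"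
      by (simp add: algebra_simps)
    have "b (Suc m) = (pochhammer a m * (a + of_nat m)) * (pochhammer (3-a) m * (3-a + of_nat m))
       / ((pochhammer c (m+3) * (c + of_nat m+3)) * (fact (m+2) * (of_nat m+3))) * (x0 ^ m * x0)"
      unfolding b_def 3 4 pochhammer_Suc by simp
    moreover have "(A * u) * (B * v) / ((C * w) * (D * k)) * (X * x0) * (w * k) = u * v * x0 * (A * B / (C * D) * X)"
      if "w \<noteq> 0" "k \<noteq> 0" for A B C D X u v w k :: complex
      using that by (simp add: divide_simps)
    ultimately show ?thesis unfolding b_def using nz nz2 by simp
  qed
  have x0: "x0 = (2 - s) / 4" by (simp add: x0_def s_def field_simps)
  have Rc: "R * c = (2 - s) * (3 * s) * (13/12 - a/2)" using c[of 0] by (simp add: R_def)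
  \<comment> \<open>The telescoping equation after division by \<open>(a - 1) (a - 2) x0\<^sup>2 b m\<close>; it uses \<open>s\<^sup>2 = 3\<close>.\<close>
  have poly: "((a+m)*(a+m+1)*(c+m+2) - (2 - s) * (3 * s) * (13/12 - a/2)*((3-a+m)*(4-a+m))) =
    (2 - s) * (2 * s * (3 - 2*a) - 4 * (m + 1 + a)) * ((a+m)*(3-a+m)*x0) -
    (2 - s) * (2 * s * (3 - 2*a) - 4 * (m + a)) * ((c+m+2)*(m+2))" for m
    unfolding x0 c_def by (simp add: field_simps s2 ss)
  have step: "t (m+2) - R * t' (m+2) = G (Suc m) - G m" for m
  proof -
    define M :: complex where "M = of_nat m"
    have "t (m+2) - R * t' (m+2) = (a-1)*(a-2)*x0^2 * b m *
       ((a+M)*(a+M+1)*(c+M+2) - R * c * ((3-a+M)*(4-a+M)))"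
      unfolding t t' M_def by (simp add: algebra_simps)
    also have "\<dots> = (a-1)*(a-2)*x0^2 * (p (Suc m) * ((a+M)*(3-a+M)*x0 * b m) - p m * ((c+M+2)*(M+2)) * b m)"
      unfolding Rc poly p_def M_def by (simp add: algebra_simps)
    also have "\<dots> = G (Suc m) - G m"
      unfolding M_def b[symmetric] G_def by (simp add: algebra_simps)
    finally show ?thesis .
  qed
  have init: "t 0 + t 1 - R * (t' 0 + t' 1) = G 0"
  proof -
    have nz: "c \<noteq> 0" "c + 1 \<noteq> 0" "c + 2 \<noteq> 0" using c[of 0] c[of 1] c[of 2] by auto
    have b0: "b 0 = 1 / (c * (c+1) * (c+2) * 2)"
      by (simp add: b_def numeral_3_eq_3 numeral_2_eq_2 pochhammer_Suc algebra_simps)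
    have 1: "c * (t 0 + t 1) = c + a*(1-a)*x0" and 2: "(c+1) * (t' 0 + t' 1) = c + 1 + (a-2)*(3-a)*x0"
      using nz by (simp_all add: t_def t'_def distrib_left)
    have "c * (c+1) * (t 0 + t 1 - R * (t' 0 + t' 1)) = (c+1) * (c * (t 0 + t 1)) - R * c * ((c+1) * (t' 0 + t' 1))"
      by (simp add: algebra_simps)
    also have "\<dots> = (a-1)*(a-2)*x0^2 * p 0"
      unfolding 1 2 Rc unfolding x0 p_def c_def by (simp add: field_simps power2_eq_square s2 ss)
    also have "\<dots> = c * (c+1) * G 0"
    proof -
      have "c * (c+1) * (c+2) * 2 \<noteq> 0" using nz by simp
      hence "c * (c+1) * (c+2) * 2 * b 0 = 1"
        unfolding b0 times_divide_eq_right mult_1_right by (rule divide_self)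
      hence "(a-1)*(a-2)*x0^2 * p 0 = (a-1)*(a-2)*x0^2 * p 0 * (c * (c+1) * (c+2) * 2 * b 0)" by simp
      thus ?thesis by (simp add: G_def mult_ac)
    qed
    finally show ?thesis using nz by simp
  qed
  have psum: "(\<Sum>n<m+2. t n - R * t' n) = G m" for m
  proof (induction m)
    case 0 show ?case using init by (simp add: numeral_2_eq_2 algebra_simps)
  next
    case (Suc m) thus ?case using step[of m] by simp
  qed
  have "norm x0 < 1" unfolding x0_def by (rule norm_evaluation_point_less_1)
  hence ts: "t sums hypergeo_F a (1-a) c x0" "t' sums hypergeo_F (a-2) (3-a) (c+1) x0"
    unfolding t_def t'_def by (intro hypergeo_F_sums; assumption)+
  have "(\<lambda>n. t n - R * t' n) sums (hypergeo_F a (1-a) c x0 - R * hypergeo_F (a-2) (3-a) (c+1) x0)"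
    by (intro sums_diff sums_mult ts)
  hence "(\<lambda>m. \<Sum>n<m+2. t n - R * t' n) \<longlonglongrightarrow> (hypergeo_F a (1-a) c x0 - R * hypergeo_F (a-2) (3-a) (c+1) x0)"
    unfolding sums_def by (rule LIMSEQ_ignore_initial_segment)
  moreover have "G \<longlonglongrightarrow> 0"
  \<comment> \<open>\<open>G m\<close> is \<open>t (m + 2)\<close> times a rational function of \<open>m\<close> with a finite limit.\<close>
  proof -
    have inf: "filterlim (\<lambda>n. v + of_nat n :: complex) at_infinity sequentially" for v
      by (intro tendsto_add_filterlim_at_infinity[OF tendsto_const] tendsto_of_nat)
    have ev: "eventually (\<lambda>n. v + of_nat n \<noteq> (0::complex)) sequentially" for v
      using filterlim_at_infinity_imp_eventually_ne[OF inf[of v], of 0] by simp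
    have inv: "(\<lambda>n. k / (v + of_nat n :: complex)) \<longlonglongrightarrow> 0" for k v
      by (intro tendsto_divide_0[OF tendsto_const inf])
    have "(\<lambda>m. t (m+2)) \<longlonglongrightarrow> 0"
      using summable_LIMSEQ_zero[OF sums_summable[OF ts(1)]] by (rule LIMSEQ_ignore_initial_segment)
    hence "(\<lambda>m. (1 + (1-a)/(a+1 + of_nat m)) * ((2-s) * (2 * s * (3 - 2*a) / (a + of_nat m) - 4)) * t (m+2)) \<longlonglongrightarrow>
       (1 + 0) * ((2-s) * (0 - 4)) * 0"
      by (intro tendsto_intros inv)
    moreover have "eventually (\<lambda>m. (1 + (1-a)/(a+1 + of_nat m)) * ((2-s) * (2 * s * (3 - 2*a) / (a + of_nat m) - 4)) * t (m+2) = G m) sequentially"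
      using ev[of a] ev[of "a+1"]
    proof eventually_elim
      case (elim m)
      have 1: "1 + (1-a)/(a+1 + of_nat m) = (of_nat m + 2) / (a+1 + of_nat m)"
         using elim by (simp add: field_simps)
      have 2: "(2-s) * (2 * s * (3 - 2*a) / (a + of_nat m) - 4) = p m / (a + of_nat m)"
         using elim by (simp add: field_simps p_def)
      have 3: "a + of_nat m + 1 = a + 1 + of_nat m" by simp
      have "M / v * (P / u) * (K * L * u * v * W * x * B) = K * L * x * W * M * P * B"
        if "u \<noteq> 0" "v \<noteq> 0" for M P K L W x B u v :: complex
        using that by simp
      from this[OF elim] show ?case unfolding 1 2 t G_def 3 .
    qed
    ultimately show ?thesis by (auto dest: Lim_transform_eventually)
  qed
  ultimately have "hypergeo_F a (1-a) c x0 - R * hypergeo_F (a-2) (3-a) (c+1) x0 = 0"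
    unfolding psum by (rule LIMSEQ_unique)
  moreover have "5/4 - (a-2)/2 = c + 1" by (simp add: c_def field_simps)
  moreover have "1 - (a-2) = 3 - a" by simp
  ultimately show ?thesis by (simp add: R_def flip: c_def s_def)
qed

section \<open>The closed form\<close>

definition closed_form :: "complex \<Rightarrow> complex" where
  "closed_form a = of_real (2 - sqrt 3) powr (a/2 - 1/4) * Gamma (1/3) * Gamma (5/4 - a/2)
             / (3 powr (5/8 - 3*a/4) * of_real (sqrt pi)) * rGamma (13/12 - a/2)"

lemma closed_form_recurrence:
  assumes "5/4 - a/2 \<notin> \<int>\<^sub>\<le>\<^sub>0"
  shows "closed_form a = (2 - of_real (sqrt 3)) * (3 * of_real (sqrt 3)) * (13/12 - a/2) / (5/4 - a/2) * closed_form (a - 2)"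
proof -
  define s where "s = sqrt 3"
  have s: "complex_of_real (2 - s) \<noteq> 0" using sqrt3_lt_2 unfolding s_def by (simp only: of_real_eq_0_iff)
  have 1: "of_real (2 - s) powr ((a-2)/2 - 1/4) * of_real (2 - s) = of_real (2 - s) powr (a/2 - 1/4)"
  proof -
    have "of_real (2 - s) powr (a/2 - 1/4) = of_real (2 - s) powr (((a-2)/2 - 1/4) + 1)"
      by (rule arg_cong[of _ _ "\<lambda>x. of_real (2 - s) powr x"]) (simp add: field_simps)
    also have "\<dots> = of_real (2 - s) powr ((a-2)/2 - 1/4) * of_real (2 - s) powr 1"
      by (rule powr_add)
    also have "complex_of_real (2 - s) powr 1 = of_real (2 - s)"
      using s by (simp add: powr_def del: of_real_diff)
    finally show ?thesis ..
  qed
  have 2: "3 powr (5/8 - 3*(a-2)/4) = 3 powr (5/8 - 3*a/4) * (3 * of_real s)"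
  proof -
    have "3 powr (5/8 - 3*(a-2)/4) = 3 powr ((5/8 - 3*a/4) + 1 + (1/2 :: complex))"
      by (rule arg_cong[of _ _ "\<lambda>x. 3 powr x"]) (simp add: field_simps)
    also have "\<dots> = 3 powr (5/8 - 3*a/4) * 3 * 3 powr (1/2 :: complex)"
      by (simp only: powr_add) simp
    also have "(3::complex) powr (1/2) = of_real (3 powr (1/2))"
      by (subst powr_of_real[symmetric]) auto
    also have "3 powr (1/2 :: real) = s" by (simp add: powr_half_sqrt s_def)
    finally show ?thesis by simp
  qed
  have 3: "Gamma (5/4 - (a-2)/2) = (5/4 - a/2) * Gamma (5/4 - a/2)"
    using Gamma_plus1[OF assms] by (simp add: field_simps)
  have 4: "rGamma (13/12 - a/2) = (13/12 - a/2) * rGamma (13/12 - (a-2)/2)"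
    using rGamma_plus1[of "13/12 - a/2"] by (simp add: field_simps)
  have c: "5/4 - a/2 \<noteq> 0" using assms by (metis zero_in_nonpos_Ints)
  have alg: "P * E * Gc / (T * p) * (g * r) = E' * S * g / c * (P' * E * (c * Gc) / (T * S * p) * r)"
    if "P = P' * E'" "c \<noteq> 0" "S \<noteq> 0" for P E Gc T p g r E' S c P' :: complex
    using that by (simp add: divide_simps)
  have s0: "3 * complex_of_real s \<noteq> 0" by (simp add: s_def)
  show ?thesis
    unfolding closed_form_def 2[unfolded s_def] 3 4
    using alg[OF 1[symmetric] c s0] by (simp add: s_def)
qed

lemma closed_form_nonzero:
  assumes "Re a < 5/4" shows "closed_form a \<noteq> 0"
proof -
  have "complex_of_real (2 - sqrt 3) \<noteq> 0" using sqrt3_lt_2 by (simp only: of_real_eq_0_iff)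
  moreover have "5/4 - a/2 \<notin> \<int>\<^sub>\<le>\<^sub>0" "13/12 - a/2 \<notin> \<int>\<^sub>\<le>\<^sub>0" "(1/3 :: complex) \<notin> \<int>\<^sub>\<le>\<^sub>0"
    using assms by (intro Re_pos_notin_nonpos_Ints; simp)+
  hence "Gamma (5/4 - a/2) \<noteq> 0" "rGamma (13/12 - a/2) \<noteq> 0" "Gamma (1/3::complex) \<noteq> 0"
    by (simp_all add: Gamma_eq_zero_iff rGamma_eq_zero_iff)
  ultimately show ?thesis by (simp add: closed_form_def del: of_real_diff)
qed

lemma holomorphic_closed_form: "closed_form holomorphic_on {a. Re a < 5/4}"
proof -
  have "5/4 - a/2 \<notin> \<int>\<^sub>\<le>\<^sub>0" if "Re a < 5/4" for a
    using that by (intro Re_pos_notin_nonpos_Ints) simp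
  moreover have "complex_of_real (2 - sqrt 3) \<notin> \<real>\<^sub>\<le>\<^sub>0"
    using sqrt3_lt_2 by (simp only: complex_nonpos_Reals_iff) simp
  ultimately show ?thesis unfolding closed_form_def
    by (intro holomorphic_intros) auto
qed

text \<open>
  The moduli of the powers depend only on \<open>Re a\<close>, and the two Gamma factors form the quotient
  \<open>\<Gamma>(z) / \<Gamma>(z + 1/6)\<close> with \<open>z = 13/12 - a/2\<close>. The growth of \<open>1/g\<close> on a vertical strip is thereby reduced
  to a compact real interval.
\<close>

lemma norm_inverse_closed_form_le:
  assumes "Re a < 5/4"
  shows "norm (1 / closed_form a) \<le> norm (1 / closed_form (of_real (Re a)))"
proof -
  define x where "x = Re a"
  define K where "K = (2 - sqrt 3) powr (x/2 - 1/4) * norm (Gamma (1/3::complex)) / (3 powr (5/8 - 3*x/4) * sqrt pi)"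
  have Kpos: "K > 0" using sqrt3_lt_2
    by (auto simp: K_def Gamma_eq_zero_iff intro!: mult_pos_pos divide_pos_pos Re_pos_notin_nonpos_Ints)
  have eq: "norm (1 / closed_form b) = norm (Gamma (13/12 - b/2) / Gamma ((13/12 - b/2) + of_real (1/6))) / K" if "Re b = x" for b
  proof -
    have 1: "norm (complex_of_real (2 - sqrt 3) powr (b/2 - 1/4)) = (2 - sqrt 3) powr (x/2 - 1/4)"
      using sqrt3_lt_2 that by (subst norm_powr_real_powr) auto
    have 2: "norm (3 powr (5/8 - 3*b/4)) = 3 powr (5/8 - 3*x/4)"
      using that by (subst norm_powr_real_powr) auto
    have 3: "13/12 - b/2 + of_real (1/6) = 5/4 - b/2" by simp
    show ?thesis unfolding closed_form_def K_def 3 rGamma_inverse_Gamma norm_mult norm_divide 1 2 norm_inverse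
      by (simp add: divide_simps)
  qed
  have "norm (1 / closed_form a) = norm (Gamma (13/12 - a/2) / Gamma ((13/12 - a/2) + of_real (1/6))) / K"
    by (rule eq) (simp add: x_def)
  also have "\<dots> \<le> (Gamma (13/12 - x/2) / Gamma (13/12 - x/2 + 1/6)) / K"
    using norm_Gamma_quotient_le[of "13/12 - a/2" "1/6"] Kpos assms
    by (intro divide_right_mono) (auto simp: x_def)
  also have "\<dots> \<le> norm (Gamma (13/12 - of_real x/2) / Gamma ((13/12 - of_real x/2) + of_real (1/6)) :: complex) / K"
  proof -
    have "(Gamma (13/12 - of_real x/2) / Gamma ((13/12 - of_real x/2) + of_real (1/6)) :: complex)
        = of_real (Gamma (13/12 - x/2) / Gamma (13/12 - x/2 + 1/6))"
      by (simp add: Gamma_complex_of_real[symmetric])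
    hence "norm (Gamma (13/12 - of_real x/2) / Gamma ((13/12 - of_real x/2) + of_real (1/6)) :: complex)
      = \<bar>Gamma (13/12 - x/2) / Gamma (13/12 - x/2 + 1/6)\<bar>" by (simp only: norm_of_real)
    thus ?thesis using Kpos by (intro divide_right_mono) (simp_all only: abs_ge_self less_imp_le)
  qed
  also have "\<dots> = norm (1 / closed_form (of_real x))"
    by (rule eq[symmetric]) simp
  finally show ?thesis by (simp add: x_def)
qed

text \<open>
  At \<open>a = 5/6\<close> the power of 3 has exponent 0, and duplication turns \<open>\<Gamma>(1/3) \<Gamma>(5/6)\<close> into a multiple
  of \<open>\<Gamma>(2/3)\<close>, which cancels against the reciprocal Gamma factor.
\<close>

lemma closed_form_base: "closed_form (5/6) = of_real ((2 - sqrt 3) powr (1/6) * 2 powr (1/3))"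
proof -
  have d: "Gamma (1/3) * Gamma (5/6) = exp (1/3 * of_real (ln 2)) * of_real (sqrt pi) * Gamma (2/3 :: complex)"
    using Gamma_legendre_duplication[of "1/3"] by (simp add: Re_pos_notin_nonpos_Ints)
  have e: "exp (1/3 * of_real (ln 2)) = complex_of_real (2 powr (1/3))"
    by (simp add: powr_def exp_of_real[symmetric])
  have g: "Gamma (2/3 :: complex) \<noteq> 0" by (auto simp: Gamma_eq_zero_iff intro!: Re_pos_notin_nonpos_Ints)
  have p: "complex_of_real (2 - sqrt 3) powr (1/6) = of_real ((2 - sqrt 3) powr (1/6))"
    using sqrt3_lt_2 by (subst powr_of_real[symmetric]) auto
  have "closed_form (5/6) = complex_of_real (2 - sqrt 3) powr (1/6) * (Gamma (1/3) * Gamma (5/6)) / of_real (sqrt pi) / Gamma (2/3)"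
    by (simp add: closed_form_def rGamma_inverse_Gamma inverse_eq_divide)
  also have "\<dots> = of_real ((2 - sqrt 3) powr (1/6)) * of_real (2 powr (1/3))"
    unfolding d e p using g by simp
  finally show ?thesis by simp
qed

lemma hypergeo_base: "hypergeo_F (5/6) (1 - 5/6) (5/4 - (5/6)/2) (1/2 - 1/4 * of_real (sqrt 3))
   = of_real ((2 - sqrt 3) powr (1/6) * 2 powr (1/3))"
proof -
  have "hypergeo_F (5/6) (1/6) (5/6) (1/2 - 1/4 * of_real (sqrt 3)) = (1 - (1/2 - 1/4 * of_real (sqrt 3))) powr (- (1/6))"
    by (intro hypergeo_F_cancel norm_evaluation_point_less_1 Re_pos_notin_nonpos_Ints) simp
  also have "\<dots> = of_real ((1 - (1/2 - 1/4 * sqrt 3)) powr (- (1/6)))"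
    by (subst powr_of_real[symmetric]) auto
  also have "(1 - (1/2 - 1/4 * sqrt 3)) powr (- (1/6)) = (2 - sqrt 3) powr (1/6) * 2 powr (1/3)"
  proof -
    have "(1 - (1/2 - 1/4 * sqrt 3)) = inverse ((2 - sqrt 3) * 4)"
      by (rule inverse_unique[symmetric]) (simp add: algebra_simps)
    hence "(1 - (1/2 - 1/4 * sqrt 3)) powr (- (1/6)) = ((2 - sqrt 3) * 4) powr (1/6)"
      using sqrt3_lt_2 by (simp add: powr_minus inverse_powr)
    also have "\<dots> = (2 - sqrt 3) powr (1/6) * (2 powr 2) powr (1/6)"
      using sqrt3_lt_2 by (subst powr_mult) auto
    also have "(2 powr 2) powr (1/6) = 2 powr (1/3 :: real)" by (simp only: powr_powr) simp
    finally show ?thesis .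
  qed
  finally show ?thesis by simp
qed

theorem mainTheorem12:
  fixes a :: complex
  assumes "5/4 - a/2 \<notin> \<int>\<^sub>\<le>\<^sub>0"
  shows "hypergeo_F a (1 - a) (5/4 - a/2) (1/2 - 1/4 * of_real (sqrt 3)) =
           of_real (2 - sqrt 3) powr (a/2 - 1/4) * Gamma (1/3) * Gamma (5/4 - a/2)
             / (3 powr (5/8 - 3*a/4) * of_real (sqrt pi)) * rGamma (13/12 - a/2)"
proof -
  define x0 where "x0 = 1/2 - 1/4 * complex_of_real (sqrt 3)"
  define F where "F = (\<lambda>a. hypergeo_F a (1 - a) (5/4 - a/2) x0)"
  define H where "H = (\<lambda>a. F a / closed_form a)"
  define R where "R = (\<lambda>a. (2 - complex_of_real (sqrt 3)) * (3 * of_real (sqrt 3)) * (13/12 - a/2) / (5/4 - a/2))"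
  have nx0: "2 * norm x0 = 1 - sqrt 3 / 2" unfolding x0_def by (rule norm_evaluation_point)
  hence x0: "2 * norm x0 < 1" by simp
  have Frec: "F a = R a * F (a - 2)" if "5/4 - a/2 \<notin> \<int>\<^sub>\<le>\<^sub>0" for a
    unfolding F_def R_def x0_def by (rule hypergeo_recurrence[OF that])
  have Grec: "closed_form a = R a * closed_form (a - 2)" if "5/4 - a/2 \<notin> \<int>\<^sub>\<le>\<^sub>0" for a
    unfolding R_def by (rule closed_form_recurrence[OF that])
  have c: "5/4 - a/2 \<notin> \<int>\<^sub>\<le>\<^sub>0" if "Re a < 5/4" for a
    using that by (intro Re_pos_notin_nonpos_Ints) simp
  have Hhol: "H holomorphic_on {a. Re a < 5/4}"
    unfolding H_def F_def
    by (intro holomorphic_on_divide holomorphic_hypergeo_F x0 holomorphic_closed_form) (auto simp: closed_form_nonzero)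
  have Hper: "H (a - of_real 2) = H a" if "Re a < 5/4" for a
  proof -
    have "R a \<noteq> 0" using closed_form_nonzero[OF that] Grec[OF c[OF that]] by auto
    thus ?thesis unfolding H_def Frec[OF c[OF that]] Grec[OF c[OF that]] by simp
  qed
  obtain B where B: "\<And>x. x \<in> {-2..0} \<Longrightarrow> norm (1 / closed_form (of_real x)) \<le> B"
  proof -
    have "continuous_on (complex_of_real ` {-2..0}) (\<lambda>z. norm (1 / closed_form z))"
      by (intro continuous_intros continuous_on_subset[OF holomorphic_on_imp_continuous_on[OF holomorphic_closed_form]])
        (auto simp: closed_form_nonzero)
    hence "compact ((\<lambda>z. norm (1 / closed_form z)) ` complex_of_real ` {-2..0})"
      by (intro compact_continuous_image) (auto intro!: compact_continuous_image continuous_intros)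
    from compact_imp_bounded[OF this] show ?thesis
      unfolding bounded_iff using that by (auto simp: image_iff) (metis atLeastAtMost_iff)
  qed
  have Hbound: "norm (H a) \<le> exp 3 * B * exp (1 * \<bar>Im a\<bar>)" if a: "Re a \<in> {-2..-2+2}" for a
  proof -
    have "norm (F a) \<le> (sqrt 3 / 2) powr (- norm (1 - a))"
      using norm_hypergeo_F_le[of a x0] a x0 unfolding F_def nx0 by auto
    also have "\<dots> = exp (norm (1 - a) * ln (2 / sqrt 3))"
      by (simp add: powr_def ln_div algebra_simps)
    also have "\<dots> \<le> exp ((3 + \<bar>Im a\<bar>) * 1)"
    proof -
      have "norm (1 - a) \<le> \<bar>Re (1 - a)\<bar> + \<bar>Im (1 - a)\<bar>" by (rule cmod_le)
      also have "\<dots> \<le> 3 + \<bar>Im a\<bar>" using a by auto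
      finally have 1: "norm (1 - a) \<le> 3 + \<bar>Im a\<bar>" .
      have "2 / sqrt 3 \<le> 2" "1 \<le> 2 / sqrt 3" using sqrt3_lt_2 by (auto simp: divide_simps)
      hence "ln (2 / sqrt 3) \<le> 1" "0 \<le> ln (2 / sqrt 3)" using ln_le_minus_one[of "2 / sqrt 3"] by auto
      thus ?thesis using 1 by (simp only: exp_le_cancel_iff) (intro mult_mono; simp)
    qed
    also have "\<dots> = exp 3 * exp \<bar>Im a\<bar>" by (simp add: exp_add)
    finally have F: "norm (F a) \<le> exp 3 * exp \<bar>Im a\<bar>" .
    have "norm (1 / closed_form a) \<le> B"
      using norm_inverse_closed_form_le[of a] B[of "Re a"] a by auto
    hence "norm (F a) * norm (1 / closed_form a) \<le> (exp 3 * exp \<bar>Im a\<bar>) * B"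
      using F by (intro mult_mono) auto
    thus ?thesis by (simp add: H_def norm_divide mult_ac)
  qed
  have const: "H a = H (5/6)" if "Re a < 5/4" for a
    by (rule periodic_halfplane_constant[OF Hhol _ Hper _ _ Hbound that]) (use pi_gt3 in auto)
  have base: "H (5/6) = 1"
    unfolding H_def F_def x0_def hypergeo_base closed_form_base using sqrt3_lt_2 by simp
  have half: "F a = closed_form a" if "Re a < 5/4" for a
    using const[OF that, unfolded base] closed_form_nonzero[OF that] by (simp add: H_def)
  have "F a = closed_form a" if "5/4 - a/2 \<notin> \<int>\<^sub>\<le>\<^sub>0" "Re a < 5/4 + 2 * real n" for a n
    using that
  proof (induction n arbitrary: a)
    case 0 thus ?case by (simp add: half)
  next
    case (Suc n)
    have "5/4 - (a-2)/2 \<notin> \<int>\<^sub>\<le>\<^sub>0"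
      using Suc.prems(1) plus_one_in_nonpos_Ints_imp[of "5/4 - a/2"] by (auto simp: field_simps)
    hence "F (a - 2) = closed_form (a - 2)" using Suc.prems by (intro Suc.IH) auto
    thus ?case using Frec Grec Suc.prems(1) by simp
  qed
  moreover obtain n where "Re a < real n" using reals_Archimedean2 by blast
  hence "Re a < 5/4 + 2 * real n" by simp
  ultimately have "F a = closed_form a" using assms by blast
  thus ?thesis by (simp add: F_def x0_def closed_form_def)
qed

end
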